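(* For every integer $n \ge 1$, let $f(n)$ be the maximum, over all cyclic permutations $\pi$ of order $n$, of the minimum number of adjacent swaps needed to transform $\pi$ into the trivial cyclic permutation $u=(1,2,\ldots,n)$. Then \[ f(n) \le \left\lfloor \frac{(n-1)^2}{4} \right\rfloor. \]
   Context: A cyclic permutation of order $n$ is a bijective labeling of the vertices of a cycle of length $n$ by the elements of $[n]=\{1,\ldots,n\}$, where two labelings that differ by a rotation of the cycle (a cyclic shift) are considered the same; reflections are not identified. An adjacent swap transforms a cyclic permutation into the one obtained by exchanging the labels of two vertices that are adjacent along the cycle. The trivial cyclic permutation $u=(1,2,\ldots,n)$ is the labeling in which the labels $1,2,\ldots,n$ appear consecutively around the cycle in this order. *)

theory Defs
  imports Complex_Main "HOL-Combinatorics.Combinatorics"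
begin

text \<open>
  The vertices of the cycle of length \<open>n\<close> are the positions \<open>0, \<dots>, n - 1\<close>, taken modulo \<open>n\<close>, so a
  bijective labeling by \<open>[n]\<close> is a list in \<open>permutations_of_set {1..n}\<close>.
\<close>

definition rotation_rel :: "nat \<Rightarrow> (nat list \<times> nat list) set" where
  "rotation_rel n =
     {(xs, ys). xs \<in> permutations_of_set {1..n} \<and> ys \<in> permutations_of_set {1..n} \<and>
                (\<exists>k. ys = rotate k xs)}"

definition cyclic_class :: "nat \<Rightarrow> nat list \<Rightarrow> nat list set" where
  "cyclic_class n xs = rotation_rel n `` {xs}"

definition cyclic_perms :: "nat \<Rightarrow> nat list set set" where
  "cyclic_perms n = permutations_of_set {1..n} // rotation_rel n"

definition trivial_cyclic_perm :: "nat \<Rightarrow> nat list set" where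
  "trivial_cyclic_perm n = cyclic_class n [1..<Suc n]"

definition cycle_adjacent :: "nat \<Rightarrow> nat \<Rightarrow> nat \<Rightarrow> bool" where
  "cycle_adjacent n i j \<longleftrightarrow>
     i < n \<and> j < n \<and> i \<noteq> j \<and> (j = Suc i mod n \<or> i = Suc j mod n)"

definition swap_labels :: "nat \<Rightarrow> nat \<Rightarrow> nat list \<Rightarrow> nat list" where
  "swap_labels i j xs = xs[i := xs ! j, j := xs ! i]"

definition adjacent_swap :: "nat \<Rightarrow> nat list set \<Rightarrow> nat list set \<Rightarrow> bool" where
  "adjacent_swap n \<pi> \<sigma> \<longleftrightarrow>
     \<pi> \<in> cyclic_perms n \<and>
     (\<exists>xs\<in>\<pi>. \<exists>i j. cycle_adjacent n i j \<and> \<sigma> = cyclic_class n (swap_labels i j xs))"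

definition swap_distance :: "nat \<Rightarrow> nat list set \<Rightarrow> nat list set \<Rightarrow> nat" where
  "swap_distance n \<pi> \<sigma> = (LEAST k. (adjacent_swap n ^^ k) \<pi> \<sigma>)"

definition max_swap_distance :: "nat \<Rightarrow> nat" where
  "max_swap_distance n =
     Max ((\<lambda>\<pi>. swap_distance n \<pi> (trivial_cyclic_perm n)) ` cyclic_perms n)"

text \<open>
  The remaining facts show that the minimum and the maximum above are taken over nonempty sets,
  the latter finite, so that \<open>LEAST\<close> and \<open>Max\<close> have their intended meaning.
\<close>

lemma equiv_rotation_rel: "equiv (permutations_of_set {1..n}) (rotation_rel n)"
proof (rule equivI)
  show "rotation_rel n \<subseteq> permutations_of_set {1..n} \<times> permutations_of_set {1..n}"
    by (auto simp: rotation_rel_def)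
  show "refl_on (permutations_of_set {1..n}) (rotation_rel n)"
    by (auto simp: refl_on_def rotation_rel_def intro: exI[of _ 0])
  show "sym (rotation_rel n)"
  proof (rule symI)
    fix xs ys assume *: "(xs, ys) \<in> rotation_rel n"
    then obtain k where k: "ys = rotate k xs" by (auto simp: rotation_rel_def)
    have "rotate (length xs - k mod length xs) (rotate (k mod length xs) xs) = xs"
    proof (cases "xs = []")
      case False
      then have "length xs - k mod length xs + k mod length xs = length xs"
        by (simp add: less_imp_le)
      then show ?thesis by (simp add: rotate_rotate)
    qed simp
    then have "xs = rotate (length xs - k mod length xs) ys"
      by (metis k rotate_conv_mod)
    then show "(ys, xs) \<in> rotation_rel n" using * by (auto simp: rotation_rel_def)
  qed
  show "trans (rotation_rel n)"
    by (rule transI) (auto simp: rotation_rel_def rotate_rotate)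
qed

lemma finite_cyclic_perms: "finite (cyclic_perms n)"
  unfolding cyclic_perms_def
  by (rule finite_quotient) (auto simp: rotation_rel_def)

lemma cyclic_class_in_cyclic_perms:
  "xs \<in> permutations_of_set {1..n} \<Longrightarrow> cyclic_class n xs \<in> cyclic_perms n"
  by (simp add: cyclic_class_def cyclic_perms_def quotientI)

lemma self_in_cyclic_class:
  "xs \<in> permutations_of_set {1..n} \<Longrightarrow> xs \<in> cyclic_class n xs"
  using equiv_class_self[OF equiv_rotation_rel] by (simp add: cyclic_class_def)

lemma upt_in_permutations_of_set: "[1..<Suc n] \<in> permutations_of_set {1..n}"
  by (auto simp: permutations_of_set_def)

lemma trivial_cyclic_perm_in_cyclic_perms: "trivial_cyclic_perm n \<in> cyclic_perms n"
  unfolding trivial_cyclic_perm_def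
  by (intro cyclic_class_in_cyclic_perms upt_in_permutations_of_set)

lemma adjacent_swaps_move_to_front:
  assumes "u @ a @ y # b \<in> permutations_of_set {1..n}"
  shows "(adjacent_swap n)\<^sup>*\<^sup>* (cyclic_class n (u @ a @ y # b)) (cyclic_class n (u @ y # a @ b))"
  using assms
proof (induction a arbitrary: b rule: rev_induct)
  case (snoc x a)
  let ?xs = "u @ a @ x # y # b" and ?ys = "u @ a @ y # x # b"
  let ?i = "length u + length a"
  have xs: "?xs \<in> permutations_of_set {1..n}" using snoc.prems by simp
  then have ys: "?ys \<in> permutations_of_set {1..n}" by (auto simp: permutations_of_set_def)
  have len: "length ?xs = n" using length_finite_permutations_of_set[OF xs] by simp
  then have "cycle_adjacent n ?i (Suc ?i)" by (auto simp: cycle_adjacent_def)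
  moreover have "swap_labels ?i (Suc ?i) ?xs = ?ys"
    by (simp add: swap_labels_def nth_append list_update_append)
  ultimately have "adjacent_swap n (cyclic_class n ?xs) (cyclic_class n ?ys)"
    unfolding adjacent_swap_def
    using cyclic_class_in_cyclic_perms[OF xs] self_in_cyclic_class[OF xs] by metis
  then show ?case using snoc.IH[OF ys] by simp
qed simp

lemma adjacent_swaps_connect:
  assumes "u @ xs \<in> permutations_of_set {1..n}" and "mset xs = mset ys"
  shows "(adjacent_swap n)\<^sup>*\<^sup>* (cyclic_class n (u @ xs)) (cyclic_class n (u @ ys))"
  using assms
proof (induction ys arbitrary: u xs)
  case (Cons y ys)
  then have "y \<in> set xs" by (metis list.set_intros(1) mset_eq_setD)
  then obtain a b where ab: "xs = a @ y # b" by (meson split_list)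
  then have m: "mset (a @ b) = mset ys" using Cons.prems(2) by simp
  have "(u @ [y]) @ a @ b \<in> permutations_of_set {1..n}"
    using Cons.prems(1) ab by (auto simp: permutations_of_set_def)
  from Cons.IH[OF this m] adjacent_swaps_move_to_front[of u a y b n] Cons.prems(1) ab
  show ?case by auto
qed simp

lemma trivial_cyclic_perm_reachable:
  assumes "\<pi> \<in> cyclic_perms n"
  shows "\<exists>k. (adjacent_swap n ^^ k) \<pi> (trivial_cyclic_perm n)"
proof -
  from assms obtain xs where xs: "xs \<in> permutations_of_set {1..n}" "\<pi> = cyclic_class n xs"
    by (auto simp: cyclic_perms_def cyclic_class_def elim!: quotientE)
  have "mset xs = mset [1..<Suc n]"
    using xs(1) upt_in_permutations_of_set[of n]
    by (intro set_eq_iff_mset_eq_distinct[THEN iffD1]) (auto simp: permutations_of_set_def)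
  then have "(adjacent_swap n)\<^sup>*\<^sup>* \<pi> (trivial_cyclic_perm n)"
    using adjacent_swaps_connect[of "[]" xs n "[1..<Suc n]"] xs
    by (simp add: trivial_cyclic_perm_def)
  then show ?thesis by (rule rtranclp_imp_relpowp)
qed

end

theory Submission
  imports Defs
begin

text \<open>
  Lift the labels to integers, one per position, with distinct residues modulo \<open>n\<close>, and extend
  periodically to an affine permutation. A lift can be sorted with \<open>\<Sum>\<^sub>i\<^sub><\<^sub>j \<bar>\<lfloor>(w\<^sub>j - w\<^sub>i) / n\<rfloor>\<bar>\<close> adjacent
  swaps (Shi's formula for the affine length).

  For each of the \<open>n\<close> rotations of the target, take the lift in which every label travels clockwise
  by less than \<open>n\<close> steps. Two labels whose cyclic distance is \<open>e\<close> in the given permutation and \<open>d\<close> in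
  the trivial one cross for exactly \<open>\<bar>d - e\<bar>\<close> of these rotations, and
  \<open>\<bar>d - e\<bar> \<le> \<bar>d - n/2\<bar> + \<bar>e - n/2\<bar>\<close>. The right-hand side summed over all pairs does not depend on the
  permutation and is at most \<open>n (n - 1)\<^sup>2 / 4\<close>, so some rotation has at most \<open>(n - 1)\<^sup>2 / 4\<close> crossings.
\<close>

section \<open>Shi's length of a lift, under rotation and swap\<close>

fun lifted_inversions :: "int \<Rightarrow> int list \<Rightarrow> int" where
  "lifted_inversions N [] = 0"
| "lifted_inversions N (x # xs) = (\<Sum>y\<leftarrow>xs. \<bar>(y - x) div N\<bar>) + lifted_inversions N xs"

definition lifted_label :: "nat \<Rightarrow> int \<Rightarrow> nat" where
  "lifted_label n x = Suc (nat (x mod int n))"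

definition lifted_perm :: "nat \<Rightarrow> int list \<Rightarrow> bool" where
  "lifted_perm n ws \<longleftrightarrow> length ws = n \<and> distinct (map (\<lambda>x. x mod int n) ws)"

lemma lifted_inversions_nonneg: "0 \<le> lifted_inversions N xs"
  by (induction xs) (auto intro!: add_nonneg_nonneg sum_list_nonneg)

lemma lifted_inversions_snoc:
  "lifted_inversions N (xs @ [y]) = lifted_inversions N xs + (\<Sum>x\<leftarrow>xs. \<bar>(y - x) div N\<bar>)"
  by (induction xs) auto

lemma div_uminus_nondvd:
  fixes a N :: int
  assumes "N > 0" "\<not> N dvd a"
  shows "(- a) div N = - (a div N) - 1"
  using assms by (simp add: zdiv_zminus1_eq_if dvd_eq_mod_eq_0)

text \<open>Moving \<open>x\<close> to the end as \<open>x + N\<close> only shifts the window of the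
  same periodic sequence. Termwise, floor(-a/N) = -floor(a/N) - 1 for \<open>a\<close> not divisible
  by \<open>N\<close>, and the added \<open>N\<close> cancels the -1.\<close>

lemma lifted_inversions_rotate:
  assumes "N > 0" "\<And>y. y \<in> set xs \<Longrightarrow> \<not> N dvd (y - x)"
  shows "lifted_inversions N (xs @ [x + N]) = lifted_inversions N (x # xs)"
proof -
  have "\<bar>(x + N - y) div N\<bar> = \<bar>(y - x) div N\<bar>" if "y \<in> set xs" for y
  proof -
    have "(x + N - y) div N = (- (y - x)) div N + 1"
      using div_add_self2[of N "- (y - x)"] assms(1) by (simp add: algebra_simps)
    then show ?thesis using div_uminus_nondvd[OF assms(1) assms(2)[OF that]] by simp
  qed
  then show ?thesis by (simp add: lifted_inversions_snoc cong: map_cong)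
qed

text \<open>Only the pair \<open>x\<close>, \<open>y\<close> changes its term: with k = (x - y) div
  N >= 0 it contributes k + 1 in descending and k in ascending order.\<close>

lemma lifted_inversions_swap:
  assumes "N > 0" "\<not> N dvd (x - y)" "y < x"
  shows "lifted_inversions N (u @ x # y # v) = lifted_inversions N (u @ y # x # v) + 1"
proof (induction u)
  case Nil
  have "(y - x) div N = - ((x - y) div N) - 1"
    using div_uminus_nondvd[OF assms(1,2)] by simp
  moreover have "(x - y) div N \<ge> 0"
    using assms by (simp add: pos_imp_zdiv_nonneg_iff)
  ultimately show ?case by simp
qed (simp add: algebra_simps)

section \<open>Lifts as representatives of cyclic permutations\<close>

lemma lifted_perm_labels:
  assumes "lifted_perm n ws"
  shows "map (lifted_label n) ws \<in> permutations_of_set {1..n}"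
proof -
  have len: "length ws = n" and d: "distinct (map (\<lambda>x. x mod int n) ws)"
    using assms by (auto simp: lifted_perm_def)
  have dist: "distinct (map (lifted_label n) ws)"
  proof (cases "n = 0")
    case False
    then show ?thesis using d
      by (auto simp: distinct_map inj_on_def lifted_label_def nat_eq_iff)
  qed (use len in simp)
  have "set (map (lifted_label n) ws) \<subseteq> {1..n}"
  proof (cases "n = 0")
    case False
    then show ?thesis by (auto simp: lifted_label_def Suc_le_eq nat_less_iff)
  qed (use len in simp)
  moreover have "card (set (map (lifted_label n) ws)) = card {1..n}"
    using distinct_card[OF dist] len by simp
  ultimately have "set (map (lifted_label n) ws) = {1..n}"
    by (intro card_subset_eq) auto
  with dist show ?thesis by (intro permutations_of_setI)
qed

lemma cyclic_class_rotate:
  assumes "xs \<in> permutations_of_set {1..n}"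
  shows "cyclic_class n (rotate k xs) = cyclic_class n xs"
proof -
  have "rotate k xs \<in> permutations_of_set {1..n}"
    using assms by (auto simp: permutations_of_set_def)
  then have "(xs, rotate k xs) \<in> rotation_rel n" using assms by (auto simp: rotation_rel_def)
  then show ?thesis
    unfolding cyclic_class_def using equiv_class_eq[OF equiv_rotation_rel] by metis
qed

text \<open>Swaps inside the list suffice: one across the seam of the cycle becomes internal after a
  rotation of the list.\<close>

lemma adjacent_swap_append:
  assumes xs: "u @ x # y # v \<in> permutations_of_set {1..n}"
  shows "adjacent_swap n (cyclic_class n (u @ x # y # v)) (cyclic_class n (u @ y # x # v))"
proof -
  let ?xs = "u @ x # y # v" and ?i = "length u"
  have "length ?xs = n" using length_finite_permutations_of_set[OF xs] by simp
  then have "cycle_adjacent n ?i (Suc ?i)" by (auto simp: cycle_adjacent_def)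
  moreover have "swap_labels ?i (Suc ?i) ?xs = u @ y # x # v"
    by (simp add: swap_labels_def nth_append list_update_append)
  ultimately show ?thesis
    unfolding adjacent_swap_def
    using cyclic_class_in_cyclic_perms[OF xs] self_in_cyclic_class[OF xs] by metis
qed

section \<open>Sorting a lift by adjacent swaps\<close>

lemma not_sorted_descent:
  "\<not> sorted ws \<Longrightarrow> \<exists>u x y v. ws = u @ x # y # v \<and> y < x"
proof -
  assume "\<not> sorted ws"
  then obtain i where i: "Suc i < length ws" "ws ! Suc i < ws ! i"
    by (auto simp: sorted_iff_nth_Suc not_le)
  then have "ws = take i ws @ ws ! i # ws ! Suc i # drop (Suc (Suc i)) ws"
    by (metis Cons_nth_drop_Suc Suc_lessD append_take_drop_id)
  with i(2) show ?thesis by blast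
qed

text \<open>Increasing integers at n places inside a window of length n are consecutive: they grow
  by at least 1 per step, and the bounds at the two ends squeeze them. The labels are then a
  rotation of 1, ..., n.\<close>

lemma lifted_window_trivial:
  assumes p: "lifted_perm n (x # xs)" and "sorted (x # xs)" and l: "last (x # xs) < x + int n"
  shows "cyclic_class n (map (lifted_label n) (x # xs)) = trivial_cyclic_perm n"
proof -
  define ws where "ws = x # xs"
  have len: "length ws = n" and "n > 0" using p by (auto simp: lifted_perm_def ws_def)
  have "distinct ws" using p by (auto simp: lifted_perm_def ws_def distinct_map)
  with assms(2) have "sorted_wrt (<) ws" 
    by (simp only: ws_def strict_sorted_iff)
  then have step: "ws ! i + 1 \<le> ws ! Suc i" if "Suc i < n" for i
    using that len sorted_wrt_nth_less[of "(<)" ws i "Suc i"] by auto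
  have gap: "ws ! i + int k \<le> ws ! (i + k)" if "i + k < n" for i k
    using that
  proof (induction k)
    case (Suc k)
    then show ?case using step[of "i + k"] by simp
  qed simp
  have last: "ws ! (n - 1) < x + int n"
    using l len last_conv_nth[of ws] by (auto simp: ws_def)
  have eq: "ws ! i = x + int i" if "i < n" for i
  proof (rule antisym)
    show "x + int i \<le> ws ! i" using gap[of 0 i] that by (simp add: ws_def)
    show "ws ! i \<le> x + int i" using gap[of i "n - 1 - i"] that last by (simp add: of_nat_diff)
  qed
  have "map (lifted_label n) ws = rotate (nat (x mod int n)) [1..<Suc n]"
  proof (rule nth_equalityI)
    fix i assume "i < length (map (lifted_label n) ws)"
    then have i: "i < n" using len by simp
    have "nat ((x + int i) mod int n) = (nat (x mod int n) + i) mod n"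
    proof -
      have "int ((nat (x mod int n) + i) mod n) = (x mod int n + int i) mod int n"
        using \<open>n > 0\<close> by (simp add: zmod_int)
      then show ?thesis by (simp add: mod_simps nat_eq_iff)
    qed
    then show "map (lifted_label n) ws ! i = rotate (nat (x mod int n)) [1..<Suc n] ! i"
      using i len eq[OF i] \<open>n > 0\<close>
      by (simp add: nth_rotate lifted_label_def del: upt_Suc)
  qed (use len in simp)
  then show ?thesis
    using cyclic_class_rotate[OF upt_in_permutations_of_set]
    by (simp add: ws_def trivial_cyclic_perm_def del: upt_Suc list.map)
qed

lemma lifted_perm_not_dvd:
  assumes "lifted_perm n (u @ x # v)" "y \<in> set u \<union> set v"
  shows "\<not> int n dvd (y - x)"
proof -
  have "x mod int n \<notin> (\<lambda>y. y mod int n) ` (set u \<union> set v)"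
    using assms(1) by (auto simp: lifted_perm_def)
  then have "y mod int n \<noteq> x mod int n" using assms(2) by (metis imageI)
  then show ?thesis by (simp add: mod_eq_dvd_iff)
qed

text \<open>The shift by n preserves residues, so the list of labels is merely rotated and the move
  costs no swap.\<close>

lemma lifted_perm_rotate:
  assumes p: "lifted_perm n (x # zs)"
  shows "lifted_perm n (zs @ [x + int n])"
    and "lifted_inversions (int n) (zs @ [x + int n]) = lifted_inversions (int n) (x # zs)"
    and "cyclic_class n (map (lifted_label n) (zs @ [x + int n])) =
         cyclic_class n (map (lifted_label n) (x # zs))"
proof -
  have "n > 0" using p by (auto simp: lifted_perm_def)
  show "lifted_perm n (zs @ [x + int n])" using p by (auto simp: lifted_perm_def)
  show "lifted_inversions (int n) (zs @ [x + int n]) = lifted_inversions (int n) (x # zs)"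
    using \<open>n > 0\<close> lifted_perm_not_dvd[of n "[]" x zs] p by (intro lifted_inversions_rotate) auto
  have "map (lifted_label n) (zs @ [x + int n]) = rotate 1 (map (lifted_label n) (x # zs))"
    by (simp add: lifted_label_def)
  then show "cyclic_class n (map (lifted_label n) (zs @ [x + int n])) =
      cyclic_class n (map (lifted_label n) (x # zs))"
    using cyclic_class_rotate[OF lifted_perm_labels[OF p], of 1] by metis
qed

text \<open>Swapping a descent lowers the length by exactly one. A lift without descents, also
  across the boundary of the list, already represents the trivial cyclic permutation.\<close>

lemma sorting_lifted_perm:
  assumes "lifted_perm n ws" "n > 0" "lifted_inversions (int n) ws = int m"
  shows "\<exists>k\<le>m. (adjacent_swap n ^^ k) (cyclic_class n (map (lifted_label n) ws)) (trivial_cyclic_perm n)"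
  using assms
proof (induction m arbitrary: ws rule: less_induct)
  case (less m)
  let ?C = "\<lambda>ws. cyclic_class n (map (lifted_label n) ws)"
  \<comment> \<open>Stated for any lift with the cyclic class of \<open>ws\<close>, so that it
    applies both to \<open>ws\<close> and to its rotation.\<close>
  have descent: ?case
    if p: "lifted_perm n (u @ x # y # v)" and "y < x"
      and inv: "lifted_inversions (int n) (u @ x # y # v) = int m"
      and C: "?C (u @ x # y # v) = ?C ws" for u x y v
  proof -
    let ?ws = "u @ y # x # v"
    have p': "lifted_perm n ?ws" using p by (auto simp: lifted_perm_def)
    have "\<not> int n dvd (x - y)"
      using lifted_perm_not_dvd[of n u y "x # v" x] p' by auto
    then have 1: "lifted_inversions (int n) ?ws + 1 = int m"
      using lifted_inversions_swap[of "int n" x y u v] \<open>n > 0\<close> \<open>y < x\<close> inv by simp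
    with lifted_inversions_nonneg[of "int n" ?ws]
    obtain m' where m': "m = Suc m'" by (cases m) auto
    then obtain k where k: "k \<le> m'" "(adjacent_swap n ^^ k) (?C ?ws) (trivial_cyclic_perm n)"
      using less.IH[of m' ?ws] p' 1 \<open>n > 0\<close> by auto
    have "adjacent_swap n (?C (u @ x # y # v)) (?C ?ws)"
      using adjacent_swap_append lifted_perm_labels[OF p] by simp
    then have "(adjacent_swap n ^^ Suc k) (?C ws) (trivial_cyclic_perm n)"
      using k(2) C by (metis relpowp_Suc_I2)
    moreover have "Suc k \<le> m" using k(1) m' by simp
    ultimately show ?thesis by blast
  qed
  show ?case
  proof (cases "sorted ws")
    case False
    then show ?thesis using not_sorted_descent[OF False] descent less.prems by blast
  next
    case True
    obtain x zs where ws: "ws = x # zs"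
      using less.prems by (cases ws) (auto simp: lifted_perm_def)
    \<comment> \<open>A sorted lift spanning more than a window of length \<open>n\<close> has its descent across the
      boundary of the list; rotating makes it visible.\<close>
    show ?thesis
    proof (cases "last ws < x + int n")
      case last: True
      have "(adjacent_swap n ^^ 0) (?C ws) (trivial_cyclic_perm n)"
        using lifted_window_trivial less.prems(1) True last by (simp add: ws)
      then show ?thesis by blast
    next
      case False
      then have "zs \<noteq> []" using \<open>n > 0\<close> by (auto simp: ws)
      then obtain u y where zs: "zs = u @ [y]" by (metis rev_exhaust)
      have "\<not> int n dvd (y - x)"
        using lifted_perm_not_dvd[of n "[]" x zs y] less.prems(1) by (simp add: ws zs)
      \<comment> \<open>Distinct residues exclude equality, so \<open>y\<close> and
        \<open>x + int n\<close> form a strict descent in the rotated list.\<close>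
      then have "y \<noteq> x + int n" by auto
      then have "x + int n < y" using False by (simp add: ws zs)
      then show ?thesis
        using descent[of u y "x + int n" "[]"] lifted_perm_rotate[of n x zs] less.prems
        by (simp add: ws zs)
    qed
  qed
qed

section \<open>Sums over pairs of positions and cyclic distances\<close>

lemma lifted_inversions_map_upt:
  "lifted_inversions N (map v [0..<n]) = (\<Sum>q<n. \<Sum>p<q. \<bar>(v q - v p) div N\<bar>)"
proof (induction n)
  case (Suc n)
  have "(\<Sum>x\<leftarrow>map v [0..<n]. \<bar>(v n - x) div N\<bar>) = (\<Sum>p<n. \<bar>(v n - v p) div N\<bar>)"
    by (simp add: comp_def interv_sum_list_conv_sum_set_nat atLeast0LessThan)
  then show ?case using Suc by (simp add: lifted_inversions_snoc)
qed simp

text \<open>Passing to ordered pairs lets the inner sum run over all positions other than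
  \<open>q\<close>, where the cyclic distances take every nonzero value.\<close>

lemma sum_triangle_symmetric:
  fixes f :: "nat \<Rightarrow> nat \<Rightarrow> int"
  assumes "\<And>p q. p < n \<Longrightarrow> q < n \<Longrightarrow> p \<noteq> q \<Longrightarrow> f p q = f q p"
  shows "2 * (\<Sum>q<n. \<Sum>p<q. f p q) = (\<Sum>q<n. \<Sum>p\<in>{..<n} - {q}. f p q)"
  using assms
proof (induction n)
  case (Suc n)
  have "(\<Sum>q<n. \<Sum>p\<in>{..<Suc n} - {q}. f p q) = (\<Sum>q<n. f n q + (\<Sum>p\<in>{..<n} - {q}. f p q))"
  proof (rule sum.cong)
    fix q assume "q \<in> {..<n}"
    then have "{..<Suc n} - {q} = insert n ({..<n} - {q})" by auto
    then show "(\<Sum>p\<in>{..<Suc n} - {q}. f p q) = f n q + (\<Sum>p\<in>{..<n} - {q}. f p q)" by simp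
  qed simp
  moreover have "{..<Suc n} - {n} = {..<n}" by auto
  moreover have "(\<Sum>q<n. f n q) = (\<Sum>p<n. f p n)" by (intro sum.cong) (auto simp: Suc.prems)
  ultimately show ?case using Suc by (simp add: sum.distrib)
qed simp

text \<open>Induction in steps of two: from n to n + 2, after re-indexing, only the end terms d = 0
  and d = n are added, each equal to n. This matches (n + 1)^2 - (n - 1)^2 = 4 n.\<close>

lemma sum_abs_centered_le: "2 * (\<Sum>d=1..<n. \<bar>2 * int d - int n\<bar>) \<le> (int n - 1)\<^sup>2"
proof (induction n rule: induct_nat_012)
  case (ge2 n)
  show ?case
  \<comment> \<open>For n = 0 the two end terms coincide.\<close>
  proof (cases "n = 0")
    case False
    have "(\<Sum>d=1..<Suc (Suc n). \<bar>2 * int d - int (Suc (Suc n))\<bar>) =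
      (\<Sum>d=0..<Suc n. \<bar>2 * int d - int n\<bar>)"
      unfolding One_nat_def sum.shift_bounds_Suc_ivl by (intro sum.cong) auto
    also have "\<dots> = (\<Sum>d=1..<n. \<bar>2 * int d - int n\<bar>) + 2 * int n"
      using False by (simp add: sum.atLeast_Suc_lessThan)
    finally show ?thesis using ge2(1) by (simp add: power2_eq_square algebra_simps)
  qed simp
qed simp_all

lemma sum_mod_shift:
  fixes h :: "int \<Rightarrow> int"
  assumes "n > 0"
  shows "(\<Sum>t<n. h ((c + int t) mod int n)) = (\<Sum>t<n. h (int t))"
proof (rule sum.reindex_bij_witness[where
      i = "\<lambda>t. nat ((int t - c) mod int n)" and j = "\<lambda>t. nat ((c + int t) mod int n)"])
  fix t assume "t \<in> {..<n}"
  then have t: "int t mod int n = int t" by simp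
  show "nat ((int (nat ((c + int t) mod int n)) - c) mod int n) = t"
    using t assms by (simp add: mod_diff_left_eq)
  show "nat ((c + int (nat ((int t - c) mod int n))) mod int n) = t"
    using t assms by (simp add: mod_add_right_eq)
  show "nat ((c + int t) mod int n) \<in> {..<n}" "nat ((int t - c) mod int n) \<in> {..<n}"
    using assms by (simp_all add: nat_less_iff)
  show "h (int (nat ((c + int t) mod int n))) = h ((c + int t) mod int n)"
    using assms by simp
qed

text \<open>Here \<open>e\<close> and \<open>d\<close> are the distances of two labels in the given
  and the trivial permutation, \<open>c\<close> and \<open>c'\<close> their displacements. With s =
  (c + t) mod n, the numerator is d unless s + d - e leaves [0, n), when it is d + n or d - n. The
  quotient is thus 0, 1 or -1, and nonzero for exactly |d - e| values of s.\<close>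

lemma sum_crossings:
  fixes d e c c' :: int
  assumes "0 < d" "d < int n" "0 < e" "e < int n" "(c' - c) mod int n = (d - e) mod int n"
  shows "(\<Sum>t<n. \<bar>(e + (c' + int t) mod int n - (c + int t) mod int n) div int n\<bar>) = \<bar>d - e\<bar>"
proof -
  have "n > 0" using assms by auto
  let ?h = "\<lambda>s. \<bar>(e + (s + (d - e)) mod int n - s) div int n\<bar>"
  have "(c' + int t) mod int n = ((c + int t) mod int n + (d - e)) mod int n" for t
  proof -
    have "(c' + int t) mod int n = ((c' - c) mod int n + (c + int t)) mod int n"
      by (simp add: mod_simps)
    also have "\<dots> = (d - e + (c + int t)) mod int n" unfolding assms(5) by (rule mod_add_left_eq)
    also have "\<dots> = (d - e + (c + int t) mod int n) mod int n" by (rule mod_add_right_eq[symmetric])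
    finally show ?thesis by (simp only: add.commute)
  qed
  then have "(\<Sum>t<n. \<bar>(e + (c' + int t) mod int n - (c + int t) mod int n) div int n\<bar>) =
      (\<Sum>t<n. ?h (int t))"
    using sum_mod_shift[OF \<open>n > 0\<close>, of ?h c] by simp
  also have "\<dots> = (\<Sum>t<n. if int t + (d - e) < 0 \<or> int n \<le> int t + (d - e) then 1 else 0)"
  proof (rule sum.cong)
    fix t assume "t \<in> {..<n}"
    then have t: "t < n" by simp
    let ?s = "int t + (d - e)"
    consider "?s < 0" | "0 \<le> ?s" "?s < int n" | "int n \<le> ?s" by linarith
    then show "?h (int t) = (if ?s < 0 \<or> int n \<le> ?s then 1 else 0)"
    proof cases
      case 1
      have "?s mod int n = (?s + int n) mod int n" by simp
      also have "\<dots> = ?s + int n" using 1 t assms by (intro mod_pos_pos_trivial) auto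
      finally have "e + ?s mod int n - int t = d + int n" by simp
      then show ?thesis using 1 assms \<open>n > 0\<close> by simp
    next
      case 2
      then have "e + ?s mod int n - int t = d" by simp
      then show ?thesis using 2 assms by simp
    next
      case 3
      have "?s mod int n = (?s - int n) mod int n" by (simp add: mod_simps)
      also have "\<dots> = ?s - int n" using 3 t assms by (intro mod_pos_pos_trivial) auto
      finally have eq: "e + ?s mod int n - int t = d - int n" by simp
      have "(d - int n) div int n = -1"
        using assms div_add_self2[of "int n" "d - int n"] by simp
      then show ?thesis using 3 eq by simp
    qed
  qed simp
  also have "\<dots> = int (card {t. t < n \<and> (int t + (d - e) < 0 \<or> int n \<le> int t + (d - e))})"
    by (simp add: sum.If_cases Collect_conj_eq lessThan_def)
  also have "{t. t < n \<and> (int t + (d - e) < 0 \<or> int n \<le> int t + (d - e))} =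
      (if d \<le> e then {..<nat (e - d)} else {nat (int n - (d - e))..<n})"
    using assms by auto
  also have "int (card \<dots>) = \<bar>d - e\<bar>" using assms by auto
  finally show ?thesis .
qed

text \<open>For fixed \<open>q\<close> the residues of x q - x p take each nonzero value exactly
  once. This is why the final bound does not depend on the permutation.\<close>

lemma sum_cyclic_gaps:
  fixes g :: "int \<Rightarrow> int"
  assumes "bij_betw x {..<n} {0..<int n}" "q < n"
  shows "(\<Sum>p\<in>{..<n} - {q}. g ((x q - x p) mod int n)) = (\<Sum>d=1..<n. g (int d))"
proof -
  have xq: "x q \<in> {0..<int n}" using assms by (auto dest: bij_betwE)
  have "bij_betw x ({..<n} - {q}) ({0..<int n} - {x q})"
    using assms xq by (intro bij_betw_DiffI) auto
  then have "(\<Sum>p\<in>{..<n} - {q}. g ((x q - x p) mod int n)) =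
      (\<Sum>a\<in>{0..<int n} - {x q}. g ((x q - a) mod int n))"
    by (rule sum.reindex_bij_betw)
  also have "\<dots> = (\<Sum>d=1..<n. g (int d))"
  proof (rule sum.reindex_bij_witness[where
        i = "\<lambda>d. (x q - int d) mod int n" and j = "\<lambda>a. nat ((x q - a) mod int n)"], goal_cases)
    case (1 a) then show ?case using xq assms(2) by (auto simp: mod_simps)
  next
    case (2 a)
    then have "(x q - a) mod int n \<noteq> 0"
      using xq by (auto simp: mod_eq_0_iff_dvd mod_eq_dvd_iff[symmetric])
    moreover have "(x q - a) mod int n \<ge> 0" using assms(2) by simp
    moreover have "(x q - a) mod int n < int n" using assms(2) by simp
    ultimately show ?case by (simp add: nat_less_iff Suc_le_eq)
  next
    case (3 d) then show ?case using xq assms(2) by (auto simp: mod_simps)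
  next
    case (4 d)
    have "(x q - int d) mod int n \<noteq> x q"
    proof
      assume "(x q - int d) mod int n = x q"
      then have "(x q - int d) mod int n = x q mod int n" using xq by simp
      then have "int n dvd int d" by (simp add: mod_eq_dvd_iff)
      then show False using 4 by (auto dest: zdvd_imp_le)
    qed
    then show ?case using assms(2) by auto
  next
    case (5 a) then show ?case using assms(2) by simp
  qed
  finally show ?thesis .
qed

text \<open>The gap from q to p is n minus the gap from p to q, and |2 g - n| is unchanged by g -> n
  - g. Hence the sum is half of that over ordered pairs, in which every \<open>q\<close> contributes
  the same centred sum.\<close>

lemma sum_triangle_gaps_le:
  assumes x: "bij_betw x {..<n} {0..<int n}"
  shows "4 * (\<Sum>q<n. \<Sum>p<q. \<bar>2 * ((x q - x p) mod int n) - int n\<bar>) \<le> int n * (int n - 1)\<^sup>2"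
proof -
  let ?f = "\<lambda>p q. \<bar>2 * ((x q - x p) mod int n) - int n\<bar>"
  have "?f p q = ?f q p" if "p < n" "q < n" "p \<noteq> q" for p q
  proof -
    have "x p \<noteq> x q" "x p \<in> {0..<int n}" "x q \<in> {0..<int n}"
      using x that by (auto simp: bij_betw_def inj_on_def)
    then have "(x q - x p) mod int n \<noteq> 0"
      by (auto simp: mod_eq_0_iff_dvd mod_eq_dvd_iff[symmetric])
    then have "(x p - x q) mod int n = int n - (x q - x p) mod int n"
      using zmod_zminus1_eq_if[of "x q - x p" "int n"] by simp
    then show ?thesis by simp
  qed
  then have "4 * (\<Sum>q<n. \<Sum>p<q. ?f p q) = 2 * (\<Sum>q<n. \<Sum>p\<in>{..<n} - {q}. ?f p q)"
    using sum_triangle_symmetric[of n ?f] by simp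
  also have "\<dots> = int n * (2 * (\<Sum>d=1..<n. \<bar>2 * int d - int n\<bar>))"
    using sum_cyclic_gaps[OF x, of _ "\<lambda>d. \<bar>2 * d - int n\<bar>"] by simp
  also have "\<dots> \<le> int n * (int n - 1)\<^sup>2"
    using sum_abs_centered_le by (intro mult_left_mono) auto
  finally show ?thesis .
qed

section \<open>Averaging over the rotations of the target\<close>

lemma exists_short_lift:
  assumes x: "bij_betw x {..<n} {0..<int n}" and "n > 0"
  shows "\<exists>v. (\<forall>p<n. v p mod int n = x p) \<and>
    4 * lifted_inversions (int n) (map v [0..<n]) \<le> (int n - 1)\<^sup>2"
proof (rule ccontr)
  \<comment> \<open>If every lift is too long, so are the n lifts built below, one for each
    rotation; their total length then contradicts the pairwise estimate.\<close>
  assume contra: "\<not> ?thesis"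
  \<comment> \<open>The label at \<open>p\<close> moves (x p - p + t) mod n places forward, towards
    the target rotated by \<open>t\<close>. Subtracting \<open>t\<close> restores the residue
    \<open>x p\<close> and leaves differences unchanged.\<close>
  define v where "v t p = int p - int t + (x p - int p + int t) mod int n" for t p :: nat
  let ?M = "\<lambda>t. lifted_inversions (int n) (map (v t) [0..<n])"
  have "v t p mod int n = x p" if "p < n" for t p
    using bij_betwE[OF x] that by (auto simp: v_def mod_simps)
  then have big: "(int n - 1)\<^sup>2 < 4 * ?M t" for t
    using contra by (meson not_le)
  \<comment> \<open>Position distances are the label distances of the identity, so one estimate
    bounds both halves.\<close>
  have id: "bij_betw int {..<n} {0..<int n}"
    by (auto simp: bij_betw_def image_int_atLeastLessThan lessThan_atLeast0)
  \<comment> \<open>The triangle inequality through n / 2, doubled, separates the label distance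
    from the position distance.\<close>
  have pair: "2 * (\<Sum>t<n. \<bar>(v t q - v t p) div int n\<bar>) \<le>
      \<bar>2 * ((x q - x p) mod int n) - int n\<bar> + \<bar>2 * ((int q - int p) mod int n) - int n\<bar>"
    if "p < q" "q < n" for p q
  proof -
    have "x p \<noteq> x q" "x p \<in> {0..<int n}" "x q \<in> {0..<int n}"
      using x that by (auto simp: bij_betw_def inj_on_def)
    then have "(x q - x p) mod int n \<noteq> 0"
      by (auto simp: mod_eq_0_iff_dvd mod_eq_dvd_iff[symmetric])
    moreover have "(x q - x p) mod int n \<ge> 0" "(x q - x p) mod int n < int n"
      using \<open>n > 0\<close> by auto
    moreover have "(x q - int q - (x p - int p)) mod int n =
        ((x q - x p) mod int n - (int q - int p)) mod int n"
      unfolding mod_diff_left_eq by (simp add: algebra_simps)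
    ultimately have "(\<Sum>t<n. \<bar>(int q - int p + (x q - int q + int t) mod int n
        - (x p - int p + int t) mod int n) div int n\<bar>)
        = \<bar>(x q - x p) mod int n - (int q - int p)\<bar>"
      using that by (intro sum_crossings) linarith+
    moreover have "(int q - int p) mod int n = int q - int p" using that by simp
    moreover have "v t q - v t p = int q - int p + (x q - int q + int t) mod int n
        - (x p - int p + int t) mod int n" for t
      by (simp add: v_def)
    ultimately have "(\<Sum>t<n. \<bar>(v t q - v t p) div int n\<bar>) =
        \<bar>(x q - x p) mod int n - (int q - int p) mod int n\<bar>" by (simp only:)
    then show ?thesis by linarith
  qed
  \<comment> \<open>The sum over rotations is moved innermost, where \<open>pair\<close>
    applies.\<close>
  have "(\<Sum>t<n. ?M t) = (\<Sum>q<n. \<Sum>t<n. \<Sum>p<q. \<bar>(v t q - v t p) div int n\<bar>)"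
    unfolding lifted_inversions_map_upt by (rule sum.swap)
  also have "\<dots> = (\<Sum>q<n. \<Sum>p<q. \<Sum>t<n. \<bar>(v t q - v t p) div int n\<bar>)"
    by (intro sum.cong refl sum.swap)
  finally have "8 * (\<Sum>t<n. ?M t) = 4 * (\<Sum>q<n. \<Sum>p<q. 2 * (\<Sum>t<n. \<bar>(v t q - v t p) div int n\<bar>))"
    by (simp add: sum_distrib_left)
  also have "\<dots> \<le> 4 * (\<Sum>q<n. \<Sum>p<q. \<bar>2 * ((x q - x p) mod int n) - int n\<bar> +
      \<bar>2 * ((int q - int p) mod int n) - int n\<bar>)"
    using pair by (intro mult_left_mono sum_mono) auto
  also have "\<dots> \<le> 2 * (int n * (int n - 1)\<^sup>2)"
    using sum_triangle_gaps_le[OF x] sum_triangle_gaps_le[OF id] by (simp add: sum.distrib)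
  finally have "4 * (\<Sum>t<n. ?M t) \<le> int n * (int n - 1)\<^sup>2" by simp
  moreover have "(\<Sum>t<n. (int n - 1)\<^sup>2) < (\<Sum>t<n. 4 * ?M t)"
    using big \<open>n > 0\<close> by (intro sum_strict_mono) auto
  ultimately show False by (simp add: sum_distrib_left)
qed

section \<open>The bound on the swap distance\<close>

lemma swap_distance_le:
  assumes "\<pi> \<in> cyclic_perms n" "n > 0"
  shows "4 * int (swap_distance n \<pi> (trivial_cyclic_perm n)) \<le> (int n - 1)\<^sup>2"
proof -
  from assms obtain xs where xs: "xs \<in> permutations_of_set {1..n}" "\<pi> = cyclic_class n xs"
    by (auto simp: cyclic_perms_def cyclic_class_def elim!: quotientE)
  have len: "length xs = n" and set: "set xs = {1..n}" and dist: "distinct xs"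
    using xs(1) length_finite_permutations_of_set[OF xs(1)] by (auto simp: permutations_of_set_def)
  \<comment> \<open>Labels 1, ..., n become residues 0, ..., n - 1, undoing the \<open>Suc\<close>
    in \<open>lifted_label\<close>.\<close>
  define x where "x p = int (xs ! p) - 1" for p
  have "bij_betw ((!) xs) {..<n} {1..n}"
    using bij_betw_nth[OF dist] len set by auto
  moreover have "bij_betw (\<lambda>a. int a - 1) {1..n} {0..<int n}"
    by (rule bij_betwI[where g = "\<lambda>b. nat (b + 1)"]) auto
  ultimately have x: "bij_betw x {..<n} {0..<int n}"
    unfolding x_def using bij_betw_trans by (fastforce simp: comp_def)
  from exists_short_lift[OF x assms(2)] obtain v where
    v: "\<And>p. p < n \<Longrightarrow> v p mod int n = x p"
       "4 * lifted_inversions (int n) (map v [0..<n]) \<le> (int n - 1)\<^sup>2" by blast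
  let ?ws = "map v [0..<n]"
  have "distinct (map x [0..<n])"
    using x by (auto simp: distinct_map bij_betw_def lessThan_atLeast0)
  moreover have "map (\<lambda>y. y mod int n) ?ws = map x [0..<n]" using v(1) by simp
  ultimately have p: "lifted_perm n ?ws" by (simp only: lifted_perm_def length_map length_upt) simp
  have "map (lifted_label n) ?ws = xs"
  proof (rule nth_equalityI)
    fix i assume "i < length (map (lifted_label n) ?ws)"
    then have i: "i < n" by simp
    then have "xs ! i \<ge> 1" using set len nth_mem[of i xs] by auto
    then show "map (lifted_label n) ?ws ! i = xs ! i"
      using i v(1)[OF i] by (simp add: lifted_label_def x_def nat_diff_distrib')
  qed (use len in simp)
  moreover obtain m where m: "lifted_inversions (int n) ?ws = int m"
    using lifted_inversions_nonneg by (metis nonneg_int_cases)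
  ultimately obtain k where "k \<le> m" "(adjacent_swap n ^^ k) \<pi> (trivial_cyclic_perm n)"
    using sorting_lifted_perm[OF p assms(2) m] xs(2) by auto
  then have "swap_distance n \<pi> (trivial_cyclic_perm n) \<le> m"
    unfolding swap_distance_def by (meson Least_le le_trans)
  then show ?thesis using v(2) m by linarith
qed

theorem theorem2p1:
  fixes n :: nat
  assumes "n \<ge> 1"
  shows "int (max_swap_distance n) \<le> \<lfloor>(real n - 1)\<^sup>2 / 4\<rfloor>"
proof -
  have "max_swap_distance n \<in> (\<lambda>\<pi>. swap_distance n \<pi> (trivial_cyclic_perm n)) ` cyclic_perms n"
    unfolding max_swap_distance_def
    using finite_cyclic_perms trivial_cyclic_perm_in_cyclic_perms by (intro Max_in) auto
  then have "4 * int (max_swap_distance n) \<le> (int n - 1)\<^sup>2"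
    using swap_distance_le assms by auto
  then have "real_of_int (4 * int (max_swap_distance n)) \<le> real_of_int ((int n - 1)\<^sup>2)"
    by (simp only: of_int_le_iff)
  \<comment> \<open>An integer is at most the floor iff it is at most the real number, so the
    rounding comes for free.\<close>
  then show ?thesis by (simp add: le_floor_iff)
qed

end
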